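(* Fix $t>0$. Then $|\chi_{s,t}(\omega)|\to e^{-\frac t2}$ as $s\to\infty$, uniformly for $\omega\in\mathbb U$. In the case $s=t$, $e^{\frac t2}|\chi_{t,t}(\omega)|\to1$ as $t\to\infty$, uniformly for $\omega\in\mathbb U$.
   Context: $\mathbb U$ is the unit circle, $\mathbb D$ the open unit disk. For $r\in\mathbb R$ let $f_r(z)=z\exp\big(\frac r2\frac{1+z}{1-z}\big)$. For $s>0$ let $\Omega_s=\{z\in\mathbb D:f_s(z)\in\mathbb D\}$. Known: $f_s$ maps $\Omega_s$ conformally onto $\mathbb D$ and extends to a homeomorphism $\overline{\Omega_s}\to\overline{\mathbb D}$, whose inverse is denoted $\chi_s:\overline{\mathbb D}\to\overline{\Omega_s}$, and $1\notin\overline{\Omega_s}$. Put $\chi_{s,t}=f_{s-t}\circ\chi_s$ on $\overline{\mathbb D}$. *)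

theory Defs
  imports "HOL-Complex_Analysis.Complex_Analysis"
begin

(* The totalised division gives "ffun r 1 = 1"; this value is never used, because the
   closure of Omega s does not contain 1 for s > 0. *)
definition ffun :: "real \<Rightarrow> complex \<Rightarrow> complex" where
  "ffun r z = z * exp (of_real (r / 2) * ((1 + z) / (1 - z)))"

definition Omega :: "real \<Rightarrow> complex set" where
  "Omega s = {z \<in> ball 0 1. ffun s z \<in> ball 0 1}"

(* For s > 0, the homeomorphic extension of ffun s from Omega s to its closure is given by
   the same formula, which is continuous away from 1.  So chi s is the inverse of the bijection
   ffun s from closure (Omega s) onto cball 0 1; it is meaningful only on cball 0 1. *)
definition chi :: "real \<Rightarrow> complex \<Rightarrow> complex" where
  "chi s = inv_into (closure (Omega s)) (ffun s)"

definition chi2 :: "real \<Rightarrow> real \<Rightarrow> complex \<Rightarrow> complex" where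
  "chi2 s t = ffun (s - t) \<circ> chi s"

end

(* Write P z = Re ((1 + z) / (1 - z)). If |f_s(z)| < 1, then s/2 P(z) < - ln |z|, and Harnack's
   inequality P(z) >= (1 - |z|) / (1 + |z|) forces |z| <= 4/s. Hence z = chi_s(omega) is close to 0,
   P(z) is close to 1, and |f_s(z)| = 1 improves the bound on |z| to exp (- s/4). The modulus of
   chi_{s,t}(omega) is exp (- t/2 P(z)), so it differs from exp (- t/2) by a factor
   exp (O(t exp (- s/4))). That f_s maps the closure of Omega_s onto the closed disk, which is
   needed for chi_s to be a right inverse, follows from Brouwer's theorem: for |omega| < 1, f_s(z) =
   omega says that z is a fixed point of z |-> omega exp (- s/2 (1 + z) / (1 - z)). *)
theory Submission
  imports Defs "HOL-Real_Asymp.Real_Asymp"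
begin

text \<open>The real part is the Poisson kernel
  \<open>(1 - (norm z)\<^sup>2) / (norm (1 - z))\<^sup>2\<close>, and its denominator is largest
  when \<open>norm (1 - z)\<close> reaches \<open>1 + norm z\<close>.\<close>

lemma harnack_half_plane_map:
  fixes z :: complex
  assumes "norm z < 1"
  shows "(1 - norm z) / (1 + norm z) \<le> Re ((1 + z) / (1 - z))"
proof -
  have ne: "z \<noteq> 1" using assms by auto
  have sq: "(norm (1 - z))\<^sup>2 \<le> (1 + norm z)\<^sup>2"
    using norm_triangle_ineq4[of 1 z] by (intro power_mono) auto
  have pos: "0 < (norm (1 - z))\<^sup>2" using ne by simp
  have pos': "0 < 1 + norm z" by (intro add_pos_nonneg) auto
  have "(norm z)\<^sup>2 = (Re z)\<^sup>2 + (Im z)\<^sup>2" "(norm (1 - z))\<^sup>2 = (1 - Re z)\<^sup>2 + (Im z)\<^sup>2"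
    by (simp_all add: cmod_power2)
  then have eq: "Re ((1 + z) / (1 - z)) = (1 - (norm z)\<^sup>2) / (norm (1 - z))\<^sup>2"
    by (simp add: Re_divide power2_eq_square algebra_simps)
  have "(1 - norm z) / (1 + norm z) = (1 - (norm z)\<^sup>2) / (1 + norm z)\<^sup>2"
    using norm_ge_zero[of z] by (simp add: divide_simps add_nonneg_eq_0_iff) algebra
  also have "\<dots> \<le> (1 - (norm z)\<^sup>2) / (norm (1 - z))\<^sup>2"
    by (rule divide_left_mono[OF sq]) (use assms pos pos' in \<open>auto simp: power_le_one\<close>)
  finally show ?thesis using eq by simp
qed

lemma half_plane_map_ge_half:
  fixes z :: complex
  assumes "norm z \<le> 1/4"
  shows "1/2 \<le> Re ((1 + z) / (1 - z))"
proof -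
  have "1/2 \<le> (1 - norm z) / (1 + norm z)"
    using assms by (subst pos_le_divide_eq) (auto intro: add_pos_nonneg)
  also have "\<dots> \<le> Re ((1 + z) / (1 - z))" using assms by (intro harnack_half_plane_map) auto
  finally show ?thesis .
qed

lemma half_plane_map_near_0:
  fixes z :: complex
  assumes "norm z \<le> 1/2"
  shows "\<bar>Re ((1 + z) / (1 - z)) - 1\<bar> \<le> 4 * norm z"
proof -
  have ne: "z \<noteq> 1" using assms by auto
  have *: "1/2 \<le> norm (1 - z)" using norm_triangle_ineq2[of 1 z] assms by simp
  have "\<bar>Re ((1 + z) / (1 - z)) - 1\<bar> = \<bar>Re ((1 + z) / (1 - z) - 1)\<bar>" by simp
  also have "\<dots> \<le> norm ((1 + z) / (1 - z) - 1)" by (rule abs_Re_le_cmod)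
  also have "(1 + z) / (1 - z) - 1 = 2 * z / (1 - z)" using ne by (simp add: field_simps)
  also have "norm \<dots> = 2 * norm z / norm (1 - z)" by (simp add: norm_divide norm_mult)
  also have "\<dots> \<le> 2 * norm z / (1/2)" using * by (intro divide_left_mono) auto
  finally show ?thesis by simp
qed

text \<open>The parameter enters the modulus only through a real exponent, so \<open>ffun s\<close>
  and \<open>ffun (s - t)\<close> can be compared at the same point.\<close>

lemma norm_ffun: "norm (ffun r z) = norm z * exp (r / 2 * Re ((1 + z) / (1 - z)))"
proof -
  have "Re (of_real (r / 2) * w) = r / 2 * Re w" for w :: complex by simp
  then show ?thesis unfolding ffun_def norm_mult norm_exp_eq_Re by metis
qed

lemma norm_Omega_le:
  assumes "s > 0" "z \<in> Omega s"
  shows "norm z \<le> 4 / s"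
proof (cases "z = 0")
  case True
  then show ?thesis using assms by simp
next
  case False
  define r where "r = norm z"
  have r: "0 < r" "r < 1" using assms False by (auto simp: Omega_def r_def)
  have "r * exp (s / 2 * Re ((1 + z) / (1 - z))) < 1"
    using assms by (auto simp: Omega_def norm_ffun r_def)
  then have "ln (r * exp (s / 2 * Re ((1 + z) / (1 - z)))) < 0" using r by (subst ln_less_zero_iff) auto
  then have "s / 2 * Re ((1 + z) / (1 - z)) < - ln r" using r by (simp add: ln_mult)
  moreover have "s / 2 * ((1 - r) / (1 + r)) \<le> s / 2 * Re ((1 + z) / (1 - z))"
    using harnack_half_plane_map[of z] assms r by (intro mult_left_mono) (auto simp: r_def)
  \<comment> \<open>This estimate of the logarithm has the same factor \<open>1 - r\<close> as the
    Harnack bound. The factor cancels, so nothing degenerates as \<open>r\<close> approaches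
    1.\<close>
  moreover have "- ln r \<le> (1 - r) / r"
    using ln_le_minus_one[of "1 / r"] r by (simp add: ln_div field_simps)
  ultimately have "s / 2 * ((1 - r) / (1 + r)) < (1 - r) / r" by linarith
  then have "(1 - r) * (s * r) < (1 - r) * (2 * (1 + r))" using r by (simp add: field_simps)
  then have "s * r < 2 * (1 + r)" using r by (subst (asm) mult_less_cancel_left_pos) auto
  moreover have "2 * (1 + r) \<le> 4" using r by simp
  ultimately have "s * r \<le> 4" by (rule order.trans[OF less_imp_le])
  then show ?thesis using assms by (simp add: r_def field_simps)
qed

lemma norm_closure_Omega_le:
  assumes "s > 0" "z \<in> closure (Omega s)"
  shows "norm z \<le> 4 / s"
proof -
  have "closure (Omega s) \<subseteq> cball 0 (4 / s)"
    by (intro closure_minimal) (use assms norm_Omega_le in auto)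
  then show ?thesis using assms by auto
qed

lemma ball_subset_ffun_Omega:
  assumes "s \<ge> 16"
  shows "ball 0 1 \<subseteq> ffun s ` Omega s"
proof
  fix \<omega> :: complex
  assume \<omega>: "\<omega> \<in> ball 0 1"
  define g where "g = (\<lambda>z. \<omega> * exp (- (of_real (s / 2) * ((1 + z) / (1 - z)))))"
  have "continuous_on (cball 0 (1/4)) g"
    unfolding g_def by (intro continuous_intros) auto
  moreover have "g \<in> cball 0 (1/4) \<rightarrow> cball 0 (1/4)"
  proof
    fix z :: complex
    assume z: "z \<in> cball 0 (1/4)"
    then have "1/2 \<le> Re ((1 + z) / (1 - z))" by (intro half_plane_map_ge_half) simp
    then have "s / 2 * (1/2) \<le> s / 2 * Re ((1 + z) / (1 - z))"
      using assms by (intro mult_left_mono) auto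
    \<comment> \<open>The value 3 suffices because \<open>exp x\<close> is at least
      \<open>1 + x\<close>: this gives the factor 4 that sends \<open>g\<close> back into the disk
      of radius 1/4.\<close>
    then have "3 \<le> s / 2 * Re ((1 + z) / (1 - z))" using assms by linarith
    then have "4 \<le> exp (s / 2 * Re ((1 + z) / (1 - z)))"
      using exp_ge_add_one_self[of "s / 2 * Re ((1 + z) / (1 - z))"] by linarith
    then have e: "exp (- (s / 2 * Re ((1 + z) / (1 - z)))) \<le> 1/4"
      by (simp add: exp_minus field_simps)
    have "Re (- (of_real (s / 2) * w)) = - (s / 2 * Re w)" for w :: complex by simp
    then have "norm (g z) = norm \<omega> * exp (- (s / 2 * Re ((1 + z) / (1 - z))))"
      unfolding g_def norm_mult norm_exp_eq_Re by metis
    also have "\<dots> \<le> 1 * (1/4)" using e \<omega> by (intro mult_mono) auto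
    finally show "g z \<in> cball 0 (1/4)" by simp
  qed
  ultimately obtain z where z: "z \<in> cball 0 (1/4)" "g z = z"
    using brouwer[of "cball (0::complex) (1/4)" g] by auto
  have "ffun s z = g z * exp (of_real (s / 2) * ((1 + z) / (1 - z)))"
    using z by (simp only: ffun_def)
  also have "\<dots> = \<omega>" by (simp add: g_def exp_minus)
  finally have "ffun s z = \<omega>" .
  moreover from this have "z \<in> Omega s" using \<omega> z by (auto simp: Omega_def)
  ultimately show "\<omega> \<in> ffun s ` Omega s" by blast
qed

text \<open>Compactness carries surjectivity to the boundary: the image of the compact closure is
  closed and contains the open disk. The bound \<open>4 / s\<close> keeps the closure away from 1,
  where the formula is singular.\<close>

lemma cball_subset_ffun_closure_Omega:
  assumes "s \<ge> 16"
  shows "cball 0 1 \<subseteq> ffun s ` closure (Omega s)"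
proof -
  have "4 / s < 1" using assms by simp
  then have "1 \<notin> closure (Omega s)" using norm_closure_Omega_le[of s 1] assms by force
  then have "continuous_on (closure (Omega s)) (ffun s)"
    unfolding ffun_def by (intro continuous_intros) auto
  moreover have "bounded (Omega s)" by (rule bounded_subset[of "ball 0 1"]) (auto simp: Omega_def)
  ultimately have "closed (ffun s ` closure (Omega s))"
    by (intro compact_imp_closed compact_continuous_image) simp_all
  moreover have "ball 0 1 \<subseteq> ffun s ` closure (Omega s)"
    using ball_subset_ffun_Omega[OF assms] closure_subset[of "Omega s"] by blast
  ultimately have "closure (ball 0 1) \<subseteq> ffun s ` closure (Omega s)"
    by (rule closure_minimal[rotated])
  then show ?thesis by simp
qed

text \<open>For negative \<open>x\<close> the claim amounts to
  \<open>cosh x \<ge> 1\<close>.\<close>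

lemma abs_exp_minus_one_le: "\<bar>exp x - 1\<bar> \<le> exp \<bar>x\<bar> - 1" for x :: real
proof (cases "x \<ge> 0")
  case False
  then show ?thesis using cosh_real_ge_1[of x] by (simp add: cosh_field_def)
qed simp

lemma norm_chi2_bound:
  assumes "s \<ge> 16" "norm \<omega> = 1"
  shows "\<bar>exp (t / 2) * norm (chi2 s t \<omega>) - 1\<bar> \<le> exp (2 * \<bar>t\<bar> * exp (- s / 4)) - 1"
proof -
  define z where "z = chi s \<omega>"
  define P where "P = Re ((1 + z) / (1 - z))"
  have "\<omega> \<in> ffun s ` closure (Omega s)"
    using cball_subset_ffun_closure_Omega[OF assms(1)] assms by auto
  then have z: "z \<in> closure (Omega s)" "ffun s z = \<omega>"
    unfolding z_def chi_def by (simp_all add: inv_into_into f_inv_into_f)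
  have "norm z \<le> 4 / s" using z assms by (intro norm_closure_Omega_le) auto
  \<comment> \<open>The threshold 16 is chosen here: it puts \<open>z\<close> into the disk where
    \<open>P\<close> is at least 1/2.\<close>
  also have "4 / s \<le> 1/4" using assms by simp
  finally have nz: "norm z \<le> 1/4" .
  have P2: "1/2 \<le> P" unfolding P_def using nz by (rule half_plane_map_ge_half)
  have eq: "norm z * exp (s / 2 * P) = 1"
    using norm_ffun[of s z] z assms by (simp add: P_def)
  then have "norm z = exp (- (s / 2 * P))" by (simp add: exp_minus field_simps)
  \<comment> \<open>The exponential gain is essential for \<open>t = s\<close>: the bound
    \<open>4 / s\<close> would leave an error in the exponent that stays bounded but does not
    visibly tend to 0.\<close>
  also have "\<dots> \<le> exp (- s / 4)" using mult_left_mono[OF P2, of "s/2"] assms by simp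
  finally have small: "norm z \<le> exp (- s / 4)" .
  have "\<bar>P - 1\<bar> \<le> 4 * norm z" unfolding P_def by (rule half_plane_map_near_0) (use nz in simp)
  then have "\<bar>1 - P\<bar> \<le> 4 * exp (- s / 4)" using small by linarith
  then have "\<bar>t\<bar> / 2 * \<bar>1 - P\<bar> \<le> \<bar>t\<bar> / 2 * (4 * exp (- s / 4))"
    by (intro mult_left_mono) auto
  then have e: "\<bar>t / 2 * (1 - P)\<bar> \<le> 2 * \<bar>t\<bar> * exp (- s / 4)" by (simp add: abs_mult)
  have "norm (chi2 s t \<omega>) = norm z * exp ((s - t) / 2 * P)"
    by (simp add: chi2_def norm_ffun z_def P_def)
  \<comment> \<open>The first summand is split off because its exponential cancels
    \<open>norm z\<close>, by \<open>norm (ffun s z) = 1\<close>.\<close>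
  also have "(s - t) / 2 * P = s / 2 * P + - (t / 2 * P)" by (simp add: field_simps)
  also have "norm z * exp \<dots> = exp (- (t / 2 * P))"
    using eq by (simp only: exp_add mult.assoc[symmetric] mult_1)
  finally have "exp (t / 2) * norm (chi2 s t \<omega>) = exp (t / 2 * (1 - P))"
    by (simp add: exp_add[symmetric] algebra_simps)
  then have "\<bar>exp (t / 2) * norm (chi2 s t \<omega>) - 1\<bar> \<le> exp \<bar>t / 2 * (1 - P)\<bar> - 1"
    by (simp only: abs_exp_minus_one_le)
  also have "\<dots> \<le> exp (2 * \<bar>t\<bar> * exp (- s / 4)) - 1" using e by (simp only: exp_le_cancel_iff diff_right_mono)
  finally show ?thesis .
qed

text \<open>Letting the second parameter depend on \<open>s\<close> covers both claims: \<tau> is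
  constant for fixed \<open>t\<close>, and the identity for \<open>s = t\<close>. Uniformity holds
  because the bound in \<open>norm_chi2_bound\<close> does not involve \<omega>.\<close>

lemma uniform_limit_norm_chi2:
  assumes "((\<lambda>s. exp (2 * \<bar>\<tau> s\<bar> * exp (- s / 4)) - 1) \<longlongrightarrow> 0) at_top"
  shows "uniform_limit (sphere 0 1) (\<lambda>s \<omega>. exp (\<tau> s / 2) * norm (chi2 s (\<tau> s) \<omega>)) (\<lambda>\<omega>. 1) at_top"
proof (rule uniform_limitI)
  fix e :: real
  assume "e > 0"
  with assms have "\<forall>\<^sub>F s in at_top. exp (2 * \<bar>\<tau> s\<bar> * exp (- s / 4)) - 1 < e"
    by (rule order_tendstoD)
  with eventually_ge_at_top[of 16]
  show "\<forall>\<^sub>F s in at_top. \<forall>\<omega>\<in>sphere 0 1. dist (exp (\<tau> s / 2) * norm (chi2 s (\<tau> s) \<omega>)) 1 < e"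
  proof eventually_elim
    case (elim s)
    then show ?case
      unfolding dist_real_def by (intro ballI le_less_trans[OF norm_chi2_bound]) auto
  qed
qed

theorem theorem4p25:
  "(\<forall>t::real. t > 0 \<longrightarrow>
      uniform_limit (sphere (0::complex) 1)
        (\<lambda>s \<omega>. norm (chi2 s t \<omega>)) (\<lambda>\<omega>. exp (- t / 2)) at_top) \<and>
   uniform_limit (sphere (0::complex) 1)
     (\<lambda>t \<omega>. exp (t / 2) * norm (chi2 t t \<omega>)) (\<lambda>\<omega>. 1) at_top"
proof (intro conjI allI impI)
  fix t :: real
  assume "t > 0"
  have "((\<lambda>s. exp (2 * \<bar>t\<bar> * exp (- s / 4)) - 1) \<longlongrightarrow> 0) at_top" by real_asymp
  then have "uniform_limit (sphere 0 1) (\<lambda>s \<omega>. exp (t / 2) * norm (chi2 s t \<omega>)) (\<lambda>\<omega>. 1) at_top"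
    by (rule uniform_limit_norm_chi2)
  \<comment> \<open>Multiplication by the constant \<open>exp (- t / 2)\<close> undoes the
    normalisation; it is a bounded linear map and so preserves uniform limits.\<close>
  then have "uniform_limit (sphere 0 1)
      (\<lambda>s \<omega>. exp (- t / 2) * (exp (t / 2) * norm (chi2 s t \<omega>))) (\<lambda>\<omega>. exp (- t / 2) * 1) at_top"
    by (rule bounded_linear.uniform_limit[OF bounded_linear_mult_right])
  then show "uniform_limit (sphere 0 1) (\<lambda>s \<omega>. norm (chi2 s t \<omega>)) (\<lambda>\<omega>. exp (- t / 2)) at_top"
    by (simp add: mult.assoc[symmetric] exp_add[symmetric])
next
  have "((\<lambda>s::real. exp (2 * \<bar>s\<bar> * exp (- s / 4)) - 1) \<longlongrightarrow> 0) at_top" by real_asymp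
  then show "uniform_limit (sphere 0 1) (\<lambda>t \<omega>. exp (t / 2) * norm (chi2 t t \<omega>)) (\<lambda>\<omega>. 1) at_top"
    by (rule uniform_limit_norm_chi2)
qed

end
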